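(* Let $n = p_1^{\alpha_1} p_2^{\alpha_2} \cdots p_k^{\alpha_k}$ be a natural number, where $p_1,\dots,p_k$ are distinct primes and $\alpha_1,\dots,\alpha_k \ge 1$. Then the edge connectivity of the zero divisor graph $\Gamma[\mathbb{Z}_n]$ is $$\kappa_e(\Gamma[\mathbb{Z}_n]) = r, \qquad \text{where } r = \min\{p_i-1 : i=1,2,\dots,k\}.$$
   Context: $\mathbb{Z}_n$ is the ring of integers modulo $n$. For a commutative ring $R$ with unity, let $Z[R]$ be the set of its zero divisors. The zero divisor graph $\Gamma[R]$ is the simple undirected graph with vertex set $Z^*[R] = Z[R]\setminus\{0\}$ (the non-zero zero divisors of $R$), in which two distinct vertices $v,w$ are adjacent if $vw=0$. The edge connectivity $\kappa_e(G)$ of a simple graph $G$ is the smallest number of edges of $G$ whose deletion from $G$ leaves either a disconnected graph or an empty graph.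
   Formalization: The cases n = p and n = p^2 (p prime) are excluded, since the claim fails there: for n = p the graph has no vertices, so the edge connectivity is 0, and for n = p^2 it is the complete graph on p-1 vertices, with edge connectivity p-2 rather than p-1. *)

theory Defs
  imports "HOL-Number_Theory.Residues"
begin

(* Simple undirected graphs: a vertex set with a set of two-element subsets of it as edges. *)
record 'a simple_graph =
  verts :: "'a set"
  edges :: "'a set set"

definition adjacency :: "'a simple_graph \<Rightarrow> 'a rel" where
  "adjacency G = {(u, v). u \<in> verts G \<and> v \<in> verts G \<and> u \<noteq> v \<and> {u, v} \<in> edges G}"

definition graph_connected :: "'a simple_graph \<Rightarrow> bool" where
  "graph_connected G \<longleftrightarrow> (\<forall>u \<in> verts G. \<forall>v \<in> verts G. (u, v) \<in> (adjacency G)\<^sup>*)"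

definition graph_empty :: "'a simple_graph \<Rightarrow> bool" where
  "graph_empty G \<longleftrightarrow> edges G = {}"

definition delete_edges :: "'a simple_graph \<Rightarrow> 'a set set \<Rightarrow> 'a simple_graph" where
  "delete_edges G F = \<lparr>verts = verts G, edges = edges G - F\<rparr>"

(* Deleting edges keeps every vertex, so "empty" means edgeless. It matters only for graphs with
   at most one vertex (edge connectivity 0), as an edgeless graph with two vertices is
   disconnected. For a finite graph F = edges G qualifies, so the minimum exists. *)
definition edge_connectivity :: "'a simple_graph \<Rightarrow> nat" where
  "edge_connectivity G =
     (LEAST m. \<exists>F \<subseteq> edges G. finite F \<and> card F = m \<and>
        (\<not> graph_connected (delete_edges G F) \<or> graph_empty (delete_edges G F)))"

definition zero_divisors :: "('a, 'b) ring_scheme \<Rightarrow> 'a set" where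
  "zero_divisors R =
     {x \<in> carrier R. \<exists>y \<in> carrier R - {\<zero>\<^bsub>R\<^esub>}. x \<otimes>\<^bsub>R\<^esub> y = \<zero>\<^bsub>R\<^esub>}"

definition zero_divisor_graph :: "('a, 'b) ring_scheme \<Rightarrow> 'a simple_graph" where
  "zero_divisor_graph R =
     (let V = zero_divisors R - {\<zero>\<^bsub>R\<^esub>}
      in \<lparr>verts = V,
          edges = {{v, w} | v w. v \<in> V \<and> w \<in> V \<and> v \<noteq> w \<and> v \<otimes>\<^bsub>R\<^esub> w = \<zero>\<^bsub>R\<^esub>}\<rparr>)"

end

theory Submission
  imports Defs
begin

text \<open>
  Write \<open>q\<close> for the least prime factor of \<open>n\<close>, so that \<open>r = q - 1\<close>.  The proof shows that \<open>q - 1\<close> is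
  the minimum degree of the graph and that no set of fewer than \<open>q - 1\<close> edges disconnects it.

  The annihilator of \<open>x\<close> in \<open>\<int>\<^sub>n\<close> is generated by \<open>n / d\<close>, where \<open>d = gcd x n\<close>; it has \<open>d - 1\<close> non-zero
  elements, and \<open>d \<ge> q\<close> if \<open>x\<close> is a zero divisor.  The degree of \<open>x\<close> is \<open>d - 1\<close>, or
  \<open>d - 2\<close> if \<open>x * x = 0\<close>.  As \<open>n\<close> does not divide \<open>q\<^sup>2\<close>, the loss of one can only happen for
  \<open>d > q\<close>; hence all degrees are at least \<open>q - 1\<close>, and \<open>q\<close> itself has degree \<open>q - 1\<close>.
  Deleting the edges at \<open>q\<close> isolates this vertex.

  For the lower bound, take a cut \<open>(S, T)\<close> with fewer crossing edges than the minimum degree.  Then each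
  side has a vertex all of whose neighbours lie on its own side (\<open>card_cut_ge\<close>), say \<open>x\<close> in \<open>S\<close> and
  \<open>y\<close> in \<open>T\<close>.  These two are neither adjacent nor have a common neighbour.  If a prime \<open>p\<close> divided \<open>x\<close>, \<open>y\<close>
  and \<open>n\<close>, then \<open>n / p\<close> would annihilate both of them, which is excluded; so \<open>x\<close>, \<open>y\<close> and \<open>n\<close> generate the unit
  ideal.  Consequently the annihilators of \<open>x\<close> and \<open>y\<close> annihilate each other
  (\<open>zdg_close_or_joined\<close>), and one neighbour of \<open>x\<close> is already joined to all neighbours of \<open>y\<close> by
  crossing edges, which are too many.
\<close>

section \<open>Edge cuts and minimum degree\<close>

lemma sym_adjacency: "sym (adjacency G)"
  by (auto simp: adjacency_def sym_def insert_commute)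

lemma adjacency_delete_edges:
  "adjacency (delete_edges G F) = {(u, v) \<in> adjacency G. {u, v} \<notin> F}"
  by (auto simp: adjacency_def delete_edges_def)

lemma finite_neighbours: "finite (verts G) \<Longrightarrow> finite (adjacency G `` {x})"
  by (rule finite_subset[of _ "verts G"]) (auto simp: adjacency_def)

text \<open>
  Fix \<open>s\<close> in \<open>S\<close> and send each neighbour \<open>v\<close> of \<open>s\<close> to a crossing edge: to \<open>{s, v}\<close> if \<open>v\<close> is
  outside \<open>S\<close>, and otherwise to an edge from \<open>v\<close> out of \<open>S\<close>.  The endpoints of the crossing
  edge determine \<open>v\<close>, so there are at least as many crossing edges as neighbours of \<open>s\<close>.
\<close>

lemma card_cut_ge:
  assumes fin: "finite (verts G)" and s: "s \<in> S"
    and cross: "\<And>v. v \<in> S \<Longrightarrow> \<exists>w. (v, w) \<in> adjacency G \<and> w \<notin> S"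
  shows "card (adjacency G `` {s}) \<le> card (adjacency G \<inter> S \<times> (- S))"
proof -
  obtain f where f: "\<And>v. v \<in> S \<Longrightarrow> (v, f v) \<in> adjacency G \<and> f v \<notin> S"
    using cross by metis
  define g where "g v = (if v \<in> S then (v, f v) else (s, v))" for v
  have "s \<notin> adjacency G `` {s}"
    by (auto simp: adjacency_def)
  then have "inj_on g (adjacency G `` {s})"
    by (auto simp: inj_on_def g_def split: if_splits)
  moreover have "g ` (adjacency G `` {s}) \<subseteq> adjacency G \<inter> S \<times> (- S)"
    using f s by (auto simp: g_def)
  moreover have "finite (adjacency G \<inter> S \<times> (- S))"
    by (rule finite_subset[of _ "verts G \<times> verts G"]) (auto simp: adjacency_def fin)
  ultimately show ?thesis
    by (rule card_inj_on_le)
qed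

text \<open>
  Plesnik's theorem says that edge connectivity and minimum degree agree for diameter at most two.
  Zero divisor graphs can have diameter three, and the third alternative of the hypothesis covers
  the pairs of vertices at that distance.
\<close>

lemma min_degree_le_card_disconnecting:
  assumes fin: "finite (verts G)"
    and deg: "\<And>x. x \<in> verts G \<Longrightarrow> \<delta> \<le> card (adjacency G `` {x})"
    and close: "\<And>x y. \<lbrakk>x \<in> verts G; y \<in> verts G; x \<noteq> y\<rbrakk> \<Longrightarrow>
      (x, y) \<in> adjacency G \<or> (\<exists>w. (x, w) \<in> adjacency G \<and> (w, y) \<in> adjacency G) \<or>
      adjacency G `` {x} \<times> adjacency G `` {y} \<subseteq> adjacency G"
    and F: "finite F" and disc: "\<not> graph_connected (delete_edges G F)"
  shows "\<delta> \<le> card F"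
proof (rule ccontr)
  assume "\<not> \<delta> \<le> card F"
  then have less: "card F < \<delta>" by simp
  let ?A = "adjacency G" and ?B = "adjacency (delete_edges G F)"
  obtain u v where uv: "u \<in> verts G" "v \<in> verts G" "(u, v) \<notin> ?B\<^sup>*"
    using disc by (auto simp: graph_connected_def delete_edges_def)
  define S where "S = {w \<in> verts G. (u, w) \<in> ?B\<^sup>*}"
  define T where "T = verts G - S"
  have F_cross: "{a, b} \<in> F" if "(a, b) \<in> ?A" "a \<in> S" "b \<notin> S" for a b
  proof (rule ccontr)
    assume "{a, b} \<notin> F"
    with that have "(a, b) \<in> ?B" by (simp add: adjacency_delete_edges)
    with that show False
      by (auto simp: S_def adjacency_def intro: rtrancl.rtrancl_into_rtrancl)
  qed
  have le_F: "card (?A \<inter> S \<times> (- S)) \<le> card F"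
  proof (rule card_inj_on_le)
    show "inj_on (\<lambda>(a, b). {a, b}) (?A \<inter> S \<times> (- S))"
      by (auto simp: inj_on_def doubleton_eq_iff)
    show "(\<lambda>(a, b). {a, b}) ` (?A \<inter> S \<times> (- S)) \<subseteq> F"
      using F_cross by auto
  qed (rule F)
  have "?A \<inter> T \<times> (- T) = (?A \<inter> S \<times> (- S))\<inverse>"
    using sym_adjacency[of G] by (auto simp: T_def S_def adjacency_def insert_commute)
  then have card_T: "card (?A \<inter> T \<times> (- T)) = card (?A \<inter> S \<times> (- S))"
    by simp
  have "u \<in> S" "v \<in> T"
    using uv by (auto simp: S_def T_def)
  have "\<exists>x\<in>S. ?A `` {x} \<subseteq> S"
  proof (rule ccontr)
    assume "\<not> ?thesis"
    then have "card (?A `` {u}) \<le> card (?A \<inter> S \<times> (- S))"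
      by (intro card_cut_ge fin \<open>u \<in> S\<close>) auto
    with deg[OF uv(1)] le_F less show False by simp
  qed
  moreover have "\<exists>y\<in>T. ?A `` {y} \<subseteq> T"
  proof (rule ccontr)
    assume "\<not> ?thesis"
    then have "card (?A `` {v}) \<le> card (?A \<inter> T \<times> (- T))"
      by (intro card_cut_ge fin \<open>v \<in> T\<close>) auto
    with deg[OF uv(2)] le_F card_T less show False by simp
  qed
  ultimately obtain x y where x: "x \<in> S" "?A `` {x} \<subseteq> S" and y: "y \<in> T" "?A `` {y} \<subseteq> T"
    by blast
  have xy: "x \<in> verts G" "y \<in> verts G" "x \<noteq> y"
    using x(1) y(1) by (auto simp: S_def T_def)
  have "(x, y) \<notin> ?A"
    using x y by (auto simp: T_def)
  moreover have "\<not> (\<exists>w. (x, w) \<in> ?A \<and> (w, y) \<in> ?A)"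
    using x y sym_adjacency[of G] by (auto simp: T_def dest: symD)
  ultimately have joined: "?A `` {x} \<times> ?A `` {y} \<subseteq> ?A"
    using close[OF xy] by blast
  have "\<delta> > 0"
    using less by simp
  then have "?A `` {x} \<noteq> {}"
    using deg[OF xy(1)] by (metis card.empty not_le)
  then obtain a where a: "a \<in> ?A `` {x}"
    by blast
  have "card (?A `` {y}) \<le> card F"
  proof (rule card_inj_on_le)
    show "inj_on (\<lambda>b. {a, b}) (?A `` {y})"
      by (auto simp: inj_on_def doubleton_eq_iff)
    show "(\<lambda>b. {a, b}) ` (?A `` {y}) \<subseteq> F"
    proof (rule image_subsetI)
      fix b assume b: "b \<in> ?A `` {y}"
      have "(a, b) \<in> ?A" using joined a b by blast
      moreover have "a \<in> S" "b \<notin> S" using x(2) y(2) a b by (auto simp: T_def)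
      ultimately show "{a, b} \<in> F" by (rule F_cross)
    qed
  qed (rule F)
  with deg[OF xy(2)] less show False by simp
qed

lemma degree_disconnects:
  assumes fin: "finite (verts G)" and simple: "edges G = {{u, v} |u v. (u, v) \<in> adjacency G}"
    and x: "adjacency G `` {x} \<noteq> {}"
  shows "\<exists>F \<subseteq> edges G. finite F \<and> card F = card (adjacency G `` {x}) \<and>
           \<not> graph_connected (delete_edges G F)"
proof (intro exI conjI)
  let ?F = "(\<lambda>w. {x, w}) ` (adjacency G `` {x})"
  show "?F \<subseteq> edges G"
    unfolding simple by auto
  show "finite ?F"
    using finite_neighbours[OF fin] by blast
  show "card ?F = card (adjacency G `` {x})"
    by (rule card_image) (auto simp: inj_on_def doubleton_eq_iff)
  obtain w where w: "(x, w) \<in> adjacency G"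
    using x by blast
  then have xw: "x \<in> verts G" "w \<in> verts G" "x \<noteq> w"
    by (auto simp: adjacency_def)
  have "(x, w) \<notin> (adjacency (delete_edges G ?F))\<^sup>*"
  proof
    assume "(x, w) \<in> (adjacency (delete_edges G ?F))\<^sup>*"
    then obtain z where "(x, z) \<in> adjacency (delete_edges G ?F)"
      using xw(3) by (auto elim: converse_rtranclE)
    then show False
      by (auto simp: adjacency_delete_edges)
  qed
  with xw show "\<not> graph_connected (delete_edges G ?F)"
    by (auto simp: graph_connected_def delete_edges_def)
qed

text \<open>
  A vertex of positive degree has a distinct neighbour, and the two are separated once all edges are
  gone.  So a deletion that leaves an edgeless graph is disconnecting, and the bound for disconnecting
  sets of edges covers it as well.
\<close>

lemma edge_connectivity_eq_min_degree:
  assumes fin: "finite (verts G)" and simple: "edges G = {{u, v} |u v. (u, v) \<in> adjacency G}"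
    and deg: "\<And>x. x \<in> verts G \<Longrightarrow> \<delta> \<le> card (adjacency G `` {x})"
    and close: "\<And>x y. \<lbrakk>x \<in> verts G; y \<in> verts G; x \<noteq> y\<rbrakk> \<Longrightarrow>
      (x, y) \<in> adjacency G \<or> (\<exists>w. (x, w) \<in> adjacency G \<and> (w, y) \<in> adjacency G) \<or>
      adjacency G `` {x} \<times> adjacency G `` {y} \<subseteq> adjacency G"
    and x: "card (adjacency G `` {x}) = \<delta>" and pos: "\<delta> > 0"
  shows "edge_connectivity G = \<delta>"
  unfolding edge_connectivity_def
proof (rule Least_equality)
  have ne: "adjacency G `` {x} \<noteq> {}"
    using x pos by force
  show "\<exists>F \<subseteq> edges G. finite F \<and> card F = \<delta> \<and>
      (\<not> graph_connected (delete_edges G F) \<or> graph_empty (delete_edges G F))"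
    using degree_disconnects[OF fin simple ne] x by blast
  fix m
  assume "\<exists>F \<subseteq> edges G. finite F \<and> card F = m \<and>
      (\<not> graph_connected (delete_edges G F) \<or> graph_empty (delete_edges G F))"
  then obtain F where F: "finite F" "card F = m"
    and sep: "\<not> graph_connected (delete_edges G F) \<or> graph_empty (delete_edges G F)"
    by blast
  obtain w where w: "x \<in> verts G" "w \<in> verts G" "x \<noteq> w"
    using ne by (auto simp: adjacency_def)
  have "\<not> graph_connected (delete_edges G F)"
  proof (cases "graph_empty (delete_edges G F)")
    case True
    then have "adjacency (delete_edges G F) = {}"
      by (auto simp: adjacency_def graph_empty_def)
    then show ?thesis
      using w by (auto simp: graph_connected_def delete_edges_def)
  qed (use sep in blast)
  then show "\<delta> \<le> m"
    using min_degree_le_card_disconnecting[OF fin deg close F(1)] F(2) by simp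
qed


section \<open>Annihilators modulo an integer\<close>

lemma dvd_gcd_mult_iff:
  fixes m x y a :: int
  shows "m dvd gcd x y * a \<longleftrightarrow> m dvd x * a \<and> m dvd y * a"
proof -
  have "m dvd x * a \<and> m dvd y * a \<longleftrightarrow> m dvd gcd (a * x) (a * y)"
    by (simp add: mult.commute)
  also have "gcd (a * x) (a * y) = \<bar>a * gcd x y\<bar>"
    by (simp add: abs_mult gcd_mult_distrib_int)
  finally show ?thesis
    by (simp add: mult.commute)
qed

lemma dvd_mult_gcd_iff:
  fixes N x a :: int
  shows "N dvd x * a \<longleftrightarrow> N dvd gcd x N * a"
  by (simp add: dvd_gcd_mult_iff)

lemma bij_betw_annihilator:
  fixes N x :: int
  assumes "N > 0"
  shows "bij_betw (\<lambda>i. i * (N div gcd x N)) {0<..<gcd x N} {w. 0 < w \<and> w < N \<and> N dvd x * w}"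
proof -
  define d where "d = gcd x N"
  obtain c where c: "N = d * c"
    using d_def by (meson dvdE gcd_dvd2)
  have d: "d > 0"
    using assms by (simp add: d_def)
  with assms c have c0: "c > 0"
    by (simp add: zero_less_mult_iff)
  have div: "N div d = c"
    using c d by simp
  have ann: "N dvd x * w \<longleftrightarrow> c dvd w" for w
    using d by (simp add: dvd_mult_gcd_iff[of N x] flip: d_def) (simp add: c)
  have "(\<lambda>i. i * c) ` {0<..<d} = {w. 0 < w \<and> w < N \<and> c dvd w}" (is "?L = ?R")
  proof
    show "?L \<subseteq> ?R"
      using c0 by (auto simp: c)
    show "?R \<subseteq> ?L"
    proof
      fix w assume w: "w \<in> ?R"
      then obtain i where i: "w = c * i" by (auto elim: dvdE)
      with w c0 have "i \<in> {0<..<d}"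
        by (auto simp: c zero_less_mult_iff mult.commute[of d])
      with i show "w \<in> ?L"
        by (auto simp: mult.commute)
    qed
  qed
  then show ?thesis
    using c0 unfolding d_def[symmetric] div ann by (auto simp: bij_betw_def inj_on_def)
qed

lemma card_annihilator:
  fixes N x :: int
  assumes "N > 0"
  shows "card {w. 0 < w \<and> w < N \<and> N dvd x * w} = nat (gcd x N - 1)"
  using bij_betw_same_card[OF bij_betw_annihilator[OF assms, of x]] by simp


section \<open>The zero divisor graph of the residue ring\<close>

abbreviation zdg :: "int \<Rightarrow> int simple_graph" where
  "zdg N \<equiv> zero_divisor_graph (residue_ring N)"

lemma verts_zdg:
  "verts (zdg N) = {x. 0 < x \<and> x < N \<and> (\<exists>y. 0 < y \<and> y < N \<and> N dvd x * y)}"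
proof -
  have *: "y \<in> {0..N - 1} - {0} \<longleftrightarrow> 0 < y \<and> y < N" for y :: int
    by auto
  have "x \<in> verts (zdg N) \<longleftrightarrow>
      (x \<in> {0..N - 1} - {0} \<and> (\<exists>y\<in>{0..N - 1} - {0}. N dvd x * y))" for x
    by (auto simp: zero_divisor_graph_def Let_def zero_divisors_def residue_ring_def mod_eq_0_iff_dvd)
  then show ?thesis
    unfolding * Bex_def by blast
qed

lemma finite_verts_zdg: "finite (verts (zdg N))"
  by (rule finite_subset[of _ "{0<..<N}"]) (auto simp: verts_zdg)

lemma edges_zdg:
  "edges (zdg N) =
     {{v, w} |v w. v \<in> verts (zdg N) \<and> w \<in> verts (zdg N) \<and> v \<noteq> w \<and> N dvd v * w}"
  by (simp add: zero_divisor_graph_def Let_def residue_ring_def mod_eq_0_iff_dvd)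

lemma adjacency_zdg:
  "(v, w) \<in> adjacency (zdg N) \<longleftrightarrow>
     0 < v \<and> v < N \<and> 0 < w \<and> w < N \<and> v \<noteq> w \<and> N dvd v * w"
proof -
  have "(v, w) \<in> adjacency (zdg N) \<longleftrightarrow>
      v \<in> verts (zdg N) \<and> w \<in> verts (zdg N) \<and> v \<noteq> w \<and> N dvd v * w"
    by (auto simp: adjacency_def edges_zdg doubleton_eq_iff mult.commute)
  also have "\<dots> \<longleftrightarrow> 0 < v \<and> v < N \<and> 0 < w \<and> w < N \<and> v \<noteq> w \<and> N dvd v * w"
    by (auto simp: verts_zdg) (metis mult.commute)+
  finally show ?thesis .
qed

lemma edges_zdg_eq_adjacency: "edges (zdg N) = {{u, v} |u v. (u, v) \<in> adjacency (zdg N)}"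
proof -
  have "(u, v) \<in> adjacency (zdg N) \<longleftrightarrow>
      u \<in> verts (zdg N) \<and> v \<in> verts (zdg N) \<and> u \<noteq> v \<and> N dvd u * v" for u v
    by (auto simp: adjacency_def edges_zdg doubleton_eq_iff mult.commute)
  then show ?thesis
    by (simp add: edges_zdg)
qed

lemma neighbours_zdg:
  assumes "0 < x" "x < N"
  shows "adjacency (zdg N) `` {x} = {w. 0 < w \<and> w < N \<and> N dvd x * w} - {x}"
  using assms by (auto simp: adjacency_zdg)

lemma gcd_ne_1_of_vertex:
  assumes "x \<in> verts (zdg N)"
  shows "gcd x N \<noteq> 1"
proof
  assume "gcd x N = 1"
  moreover obtain y where "0 < y" "y < N" "N dvd x * y"
    using assms by (auto simp: verts_zdg)
  ultimately have "N dvd y"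
    using dvd_mult_gcd_iff[of N x y] by simp
  with \<open>0 < y\<close> \<open>y < N\<close> show False
    using zdvd_imp_le by fastforce
qed

lemma prime_dvd_of_ne_1:
  fixes d :: int
  assumes "d > 0" "d \<noteq> 1"
  obtains p where "prime p" "p dvd d"
  using assms prime_divisor_exists[of d] by auto

text \<open>
  The annihilator of \<open>x\<close> contains \<open>d - 1\<close> non-zero elements for \<open>d = gcd x N \<ge> q\<close>.  It contains \<open>x\<close> itself
  only if \<open>N\<close> divides \<open>d\<^sup>2\<close>, so that \<open>d > q\<close> makes up for the missing loop.
\<close>

lemma min_degree_zdg:
  fixes q :: int
  assumes q_least: "\<And>p. prime p \<Longrightarrow> p dvd N \<Longrightarrow> q \<le> p"
    and ndvd: "\<not> N dvd q\<^sup>2" and x: "x \<in> verts (zdg N)"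
  shows "nat (q - 1) \<le> card (adjacency (zdg N) `` {x})"
proof -
  define d where "d = gcd x N"
  have xN: "0 < x" "x < N"
    using x by (auto simp: verts_zdg)
  have d: "d > 0" "d \<noteq> 1"
    using xN gcd_ne_1_of_vertex[OF x] by (auto simp: d_def)
  obtain p where p: "prime p" "p dvd d"
    using prime_dvd_of_ne_1[OF d] .
  have "q \<le> p"
    using q_least p by (auto simp: d_def)
  also have "p \<le> d"
    using zdvd_imp_le p d by blast
  finally have qd: "q \<le> d" .
  let ?Ann = "{w. 0 < w \<and> w < N \<and> N dvd x * w}"
  have card_Ann: "card ?Ann = nat (d - 1)"
    using card_annihilator[of N x] xN by (simp add: d_def)
  have "finite ?Ann"
    by (rule finite_subset[of _ "{0<..<N}"]) auto
  have "nat (q - 1) \<le> card (?Ann - {x})"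
  proof (cases "N dvd x * x")
    case True
    then have "N dvd gcd (x\<^sup>2) (N\<^sup>2)"
      by (simp add: power2_eq_square)
    then have "N dvd d\<^sup>2"
      by (simp add: d_def gcd_exp)
    with ndvd have "d \<noteq> q" by auto
    moreover have "card (?Ann - {x}) = card ?Ann - 1"
      using True xN by (intro card_Diff_singleton) auto
    ultimately show ?thesis
      using qd card_Ann by simp
  next
    case False
    then have "?Ann - {x} = ?Ann" by auto
    then show ?thesis
      using qd card_Ann by simp
  qed
  then show ?thesis
    by (simp add: neighbours_zdg[OF xN])
qed

text \<open>
  If a prime \<open>p\<close> divides \<open>x\<close>, \<open>y\<close> and \<open>N\<close>, then \<open>N div p\<close> annihilates both \<open>x\<close> and \<open>y\<close>: it is a common
  neighbour, or it is one of the two vertices, which are then adjacent.  Otherwise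
  \<open>gcd x y\<close> is coprime to \<open>N\<close>, and for \<open>a\<close> and \<open>b\<close> annihilating \<open>x\<close> and \<open>y\<close>
  the product \<open>a * b\<close> is killed by \<open>x\<close> and \<open>y\<close>, hence by a unit, so it is zero.
\<close>

lemma zdg_close_or_joined:
  assumes x: "x \<in> verts (zdg N)" and y: "y \<in> verts (zdg N)" and neq: "x \<noteq> y"
  shows "(x, y) \<in> adjacency (zdg N) \<or>
    (\<exists>w. (x, w) \<in> adjacency (zdg N) \<and> (w, y) \<in> adjacency (zdg N)) \<or>
    adjacency (zdg N) `` {x} \<times> adjacency (zdg N) `` {y} \<subseteq> adjacency (zdg N)"
proof -
  have xN: "0 < x" "x < N" and yN: "0 < y" "y < N"
    using x y by (auto simp: verts_zdg)
  let ?g = "gcd (gcd x y) N"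
  show ?thesis
  proof (cases "?g = 1")
    case False
    have "?g > 0" using xN by simp
    from prime_dvd_of_ne_1[OF this False] obtain p where p: "prime p" "p dvd ?g" .
    then obtain c i j where c: "N = p * c" "x = p * i" "y = p * j"
      by (auto elim!: dvdE)
    have p1: "p > 1"
      using p(1) prime_gt_1_int by blast
    have "0 < p * c"
      using c(1) xN by linarith
    then have "c > 0"
      using p1 by (simp add: zero_less_mult_iff)
    moreover from this have "c < N"
      using c(1) p1 by simp
    moreover have "N dvd x * c" "N dvd c * y"
      by (simp_all add: c)
    ultimately show ?thesis
      using xN yN neq by (cases "c = x"; cases "c = y") (auto simp: adjacency_zdg)
  next
    case True
    show ?thesis
    proof (cases "\<exists>w. (x, w) \<in> adjacency (zdg N) \<and> (w, y) \<in> adjacency (zdg N)")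
      case no_common: False
      have "(a, b) \<in> adjacency (zdg N)"
        if a: "(x, a) \<in> adjacency (zdg N)" and b: "(y, b) \<in> adjacency (zdg N)" for a b
      proof -
        have "N dvd x * (a * b)" "N dvd y * (a * b)"
          using a b dvd_mult2[of N "x * a" b] dvd_mult2[of N "y * b" a]
          by (auto simp: adjacency_zdg ac_simps)
        then have "N dvd gcd x y * (a * b)"
          by (simp add: dvd_gcd_mult_iff)
        then have "N dvd a * b"
          using True dvd_mult_gcd_iff[of N "gcd x y" "a * b"] by simp
        moreover have "a \<noteq> b"
          using no_common a b sym_adjacency[of "zdg N"] by (auto dest: symD)
        ultimately show ?thesis
          using a b by (auto simp: adjacency_zdg)
      qed
      then show ?thesis by auto
    qed blast
  qed
qed

lemma edge_connectivity_zdg: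
  fixes N q :: int
  assumes N: "N > 0" and q: "prime q" "q dvd N"
    and q_least: "\<And>p. prime p \<Longrightarrow> p dvd N \<Longrightarrow> q \<le> p"
    and ndvd: "\<not> N dvd q\<^sup>2"
  shows "edge_connectivity (zdg N) = nat (q - 1)"
proof (rule edge_connectivity_eq_min_degree)
  have q1: "q > 1"
    using q(1) prime_gt_1_int by blast
  have "q \<le> N"
    using zdvd_imp_le q N by blast
  moreover have "q \<noteq> N"
    using ndvd by auto
  ultimately have qN: "0 < q" "q < N"
    using q1 by auto
  have "gcd q N = q"
    using q(2) q1 by (simp add: gcd_proj1_iff)
  moreover have "{w. 0 < w \<and> w < N \<and> N dvd q * w} - {q} = {w. 0 < w \<and> w < N \<and> N dvd q * w}"
    using ndvd by (auto simp: power2_eq_square)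
  ultimately show "card (adjacency (zdg N) `` {q}) = nat (q - 1)"
    using card_annihilator[OF N, of q] by (simp add: neighbours_zdg[OF qN])
  show "nat (q - 1) > 0"
    using q1 by simp
  show "nat (q - 1) \<le> card (adjacency (zdg N) `` {x})" if "x \<in> verts (zdg N)" for x
    using min_degree_zdg q_least ndvd that by blast
qed (rule finite_verts_zdg edges_zdg_eq_adjacency zdg_close_or_joined; assumption)+


section \<open>The edge connectivity in terms of the factorization\<close>

theorem theorem4p3:
  fixes n k r :: nat and p \<alpha> :: "nat \<Rightarrow> nat"
  assumes "k \<ge> 1"
    and "\<And>i. i \<in> {1..k} \<Longrightarrow> prime (p i)"
    and "inj_on p {1..k}"
    and "\<And>i. i \<in> {1..k} \<Longrightarrow> \<alpha> i \<ge> 1"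
    and "n = (\<Prod>i = 1..k. p i ^ \<alpha> i)"
    and "r = Min ((\<lambda>i. p i - 1) ` {1..k})"
    and not_prime_or_prime_square: "k = 1 \<Longrightarrow> \<alpha> 1 \<ge> 3"
  shows "edge_connectivity (zero_divisor_graph (residue_ring (int n))) = r"
proof -
  have "r \<in> (\<lambda>i. p i - 1) ` {1..k}"
    unfolding assms(6) using assms(1) by (intro Min_in) auto
  then obtain m where m: "m \<in> {1..k}" "r = p m - 1"
    by blast
  have prime_m: "prime (p m)"
    using assms(2) m(1) .
  have least: "p m \<le> p i" if "i \<in> {1..k}" for i
  proof -
    have "r \<le> p i - 1"
      unfolding assms(6) using that by (intro Min_le) auto
    moreover have "p i > 0"
      using prime_gt_0_nat assms(2) that by blast
    ultimately show ?thesis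
      using m(2) by simp
  qed
  have dvd_n: "p i dvd n" if "i \<in> {1..k}" for i
  proof -
    have "p i ^ \<alpha> i dvd n"
      unfolding assms(5) using that by (intro dvd_prodI) auto
    moreover have "p i dvd p i ^ \<alpha> i"
      using assms(4)[OF that] by (intro dvd_power) auto
    ultimately show ?thesis by (rule dvd_trans[rotated])
  qed
  have "n > 0"
    unfolding assms(5) using assms(2) prime_gt_0_nat by (intro prod_pos) auto
  have "\<not> n dvd (p m)\<^sup>2"
  proof
    assume n_dvd: "n dvd (p m)\<^sup>2"
    show False
    proof (cases "k = 1")
      case True
      then have "m = 1" using m by auto
      then have "n = p m ^ \<alpha> 1" using assms(5) True by simp
      then have "\<alpha> 1 \<le> 2"
        using n_dvd power_dvd_imp_le prime_gt_1_nat[OF prime_m] by blast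
      with not_prime_or_prime_square[OF True] show False by simp
    next
      case False
      then obtain j where j: "j \<in> {1..k}" "j \<noteq> m"
        using assms(1) m(1) by (metis atLeastAtMost_iff le_antisym le_refl)
      have "p j dvd (p m)\<^sup>2"
        using dvd_n[OF j(1)] n_dvd by (rule dvd_trans)
      then have "p j = p m"
        using assms(2) j(1) prime_m by (metis prime_dvd_power primes_dvd_imp_eq)
      with assms(3) j m(1) show False by (auto dest: inj_onD)
    qed
  qed
  then have "\<not> int n dvd (int (p m))\<^sup>2"
    by (metis of_nat_dvd_iff of_nat_power)
  moreover have "int (p m) \<le> s" if s: "prime s" "s dvd int n" for s
  proof -
    obtain t where t: "s = int t"
      using s(1) prime_gt_0_int by (metis zero_less_imp_eq_int)
    with s have "prime t" "t dvd n" by auto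
    then obtain i where i: "i \<in> {1..k}" "t dvd p i ^ \<alpha> i"
      unfolding assms(5) by (auto simp: prime_dvd_prod_iff)
    then have "t = p i"
      using \<open>prime t\<close> assms(2) by (metis prime_dvd_power primes_dvd_imp_eq)
    with least[OF i(1)] t show ?thesis by simp
  qed
  ultimately have "edge_connectivity (zdg (int n)) = nat (int (p m) - 1)"
    using \<open>n > 0\<close> prime_m dvd_n[OF m(1)] by (intro edge_connectivity_zdg) auto
  also have "\<dots> = r"
    using m(2) by simp
  finally show ?thesis .
qed

end
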